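(* Let $k$ be an algebraically closed field of characteristic zero, $R=k[x_1,\dots,x_n]$, $\mathbf{m}=\langle x_1,\dots,x_n\rangle$, and let $I$ be a monomial ideal of $R$ with $\dim_k(R/I)<\infty$. Let $M=R/I$, regarded as an $R$-module. Then $$\mathfrak{R}(M)^\vee=\frac{I^\perp}{\mathbf{m}\circ I^\perp}.$$
   Context: Let $\Gamma=k[X_1,\dots,X_n]$ be the $R$-module with the apolarity action, the $k$-bilinear action determined by $x^\alpha\circ X^\beta=\frac{\beta!}{(\beta-\alpha)!}X^{\beta-\alpha}$ if $\beta_j\ge\alpha_j$ for all $j$, and $0$ otherwise. $I^\perp=\{\gamma\in\Gamma: I\circ\gamma=0\}$ is the Macaulay inverse system of $I$, an $R$-submodule of $\Gamma$, and $\mathbf{m}\circ I^\perp$ is the submodule of $I^\perp$ generated by all $a\circ\gamma$ with $a\in\mathbf{m}$, $\gamma\in I^\perp$. For an $R$-module $N$, $\mathfrak{R}(N)=\{m\in N:\text{for all }a\in R,\ a^2m=0\Rightarrow am=0\}$; for $M=R/I$ as in the claim this is a submodule of $M$. $(-)^\vee$ is the Matlis (Macaulay) dual $\mathrm{Hom}_R(-,\Gamma)$, under which $(R/I)^\vee=I^\perp$ (by $f\mapsto f(1)$). The equality in the claim is as quotients of $I^\perp$: the dual of the inclusion $\mathfrak{R}(M)\hookrightarrow M$ is identified with the canonical surjection $I^\perp\twoheadrightarrow I^\perp/(\mathbf{m}\circ I^\perp)$. *)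

theory Defs
  imports
    "HOL-Library.Poly_Mapping"
    "HOL-Algebra.Algebraic_Closure_Type"
    "HOL-Algebra.Embedded_Algebras"
begin

section \<open>Modules over a commutative ring\<close>

text \<open>
  In a module record only \<open>carrier\<close>, \<open>zero\<close>, \<open>add\<close> and \<open>smult\<close> are meaningful; the fields \<open>mult\<close>
  and \<open>one\<close>, inherited from ring records, play no role in the locale \<^locale>\<open>module\<close>.
\<close>

definition regular_module :: "'a ring \<Rightarrow> ('a, 'a) module" where
  "regular_module R = \<lparr>carrier = carrier R, monoid.mult = monoid.mult R, one = one R, zero = zero R,
     add = add R, module.smult = monoid.mult R\<rparr>"

definition quotient_module :: "('a, 'b, 'm) module_scheme \<Rightarrow> 'b set \<Rightarrow> ('a, 'b set) module" where
  "quotient_module N L = \<lparr>carrier = a_rcosets\<^bsub>N\<^esub> L,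
     monoid.mult = monoid.mult (N Quot L), one = one (N Quot L), zero = L, add = set_add N,
     module.smult = (\<lambda>r C. \<Union>x\<in>C. L +>\<^bsub>N\<^esub> (r \<odot>\<^bsub>N\<^esub> x))\<rparr>"

definition generated_submodule ::
    "'a ring \<Rightarrow> ('a, 'b, 'm) module_scheme \<Rightarrow> 'b set \<Rightarrow> 'b set" where
  "generated_submodule R N S = \<Inter>{L. submodule L R N \<and> S \<subseteq> L}"

definition module_homs ::
    "'a ring \<Rightarrow> ('a, 'b, 'm) module_scheme \<Rightarrow> ('a, 'c, 'l) module_scheme \<Rightarrow> ('b \<Rightarrow> 'c) set" where
  "module_homs R N P = {f \<in> carrier N \<rightarrow> carrier P.
     (\<forall>x\<in>carrier N. \<forall>y\<in>carrier N. f (x \<oplus>\<^bsub>N\<^esub> y) = f x \<oplus>\<^bsub>P\<^esub> f y) \<and>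
     (\<forall>r\<in>carrier R. \<forall>x\<in>carrier N. f (r \<odot>\<^bsub>N\<^esub> x) = r \<odot>\<^bsub>P\<^esub> f x)}"

definition module_isos ::
    "'a ring \<Rightarrow> ('a, 'b, 'm) module_scheme \<Rightarrow> ('a, 'c, 'l) module_scheme \<Rightarrow> ('b \<Rightarrow> 'c) set" where
  "module_isos R N P = {f \<in> module_homs R N P. bij_betw f (carrier N) (carrier P)}"

text \<open>
  Functions in HOL are total, so a homomorphism is represented by the unique function that is
  \<open>undefined\<close> outside the carrier of its domain.
\<close>

definition hom_module ::
    "'a ring \<Rightarrow> ('a, 'b, 'm) module_scheme \<Rightarrow> ('a, 'c, 'l) module_scheme \<Rightarrow> ('a, 'b \<Rightarrow> 'c) module" where
  "hom_module R N P = \<lparr>carrier = module_homs R N P \<inter> extensional (carrier N),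
     monoid.mult = undefined, one = undefined,
     zero = (\<lambda>x\<in>carrier N. \<zero>\<^bsub>P\<^esub>),
     add = (\<lambda>f g. \<lambda>x\<in>carrier N. f x \<oplus>\<^bsub>P\<^esub> g x),
     module.smult = (\<lambda>r f. \<lambda>x\<in>carrier N. r \<odot>\<^bsub>P\<^esub> f x)\<rparr>"

definition frakR :: "'a ring \<Rightarrow> ('a, 'b, 'm) module_scheme \<Rightarrow> 'b set" where
  "frakR R N = {x \<in> carrier N. \<forall>a\<in>carrier R.
     (a [^]\<^bsub>R\<^esub> (2::nat)) \<odot>\<^bsub>N\<^esub> x = \<zero>\<^bsub>N\<^esub> \<longrightarrow> a \<odot>\<^bsub>N\<^esub> x = \<zero>\<^bsub>N\<^esub>}"


section \<open>Polynomials in finitely many variables\<close>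

text \<open>
  The finite type \<open>'n\<close> indexes the variables \<open>x\<^sub>1, \<dots>, x\<^sub>n\<close>, so that \<open>n = CARD('n)\<close>; a polynomial is
  a finitely supported function from exponent vectors to coefficients, with the convolution
  product of \<^type>\<open>poly_mapping\<close>.
\<close>

type_synonym ('n, 'k) mpoly = "('n \<Rightarrow>\<^sub>0 nat) \<Rightarrow>\<^sub>0 'k"

definition mpoly_ring :: "('n, 'k::field) mpoly ring" where
  "mpoly_ring = ring_of_type_algebra"

definition monom_poly :: "('n \<Rightarrow>\<^sub>0 nat) \<Rightarrow> ('n, 'k::field) mpoly" where
  "monom_poly \<alpha> = Poly_Mapping.single \<alpha> 1"

definition var_poly :: "'n \<Rightarrow> ('n, 'k::field) mpoly" where
  "var_poly i = monom_poly (Poly_Mapping.single i 1)"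

definition const_poly :: "'k \<Rightarrow> ('n, 'k::field) mpoly" where
  "const_poly c = Poly_Mapping.single 0 c"

definition max_ideal :: "('n, 'k::field) mpoly set" where
  "max_ideal = Idl\<^bsub>mpoly_ring\<^esub> (range var_poly)"

definition monomial_ideal :: "('n, 'k::field) mpoly set \<Rightarrow> bool" where
  "monomial_ideal I \<longleftrightarrow> (\<exists>A. I = Idl\<^bsub>mpoly_ring\<^esub> (monom_poly ` A))"

text \<open>The \<open>k\<close>-vector space \<open>R/I\<close> is finite-dimensional; \<open>k\<close> acts through its image in the ring \<open>R/I\<close>.\<close>

definition finite_colength :: "('n, 'k::field) mpoly set \<Rightarrow> bool" where
  "finite_colength I \<longleftrightarrow>
     ring.finite_dimension (mpoly_ring Quot I) (range (\<lambda>c. I +>\<^bsub>mpoly_ring\<^esub> const_poly c))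
       (carrier (mpoly_ring Quot I))"


section \<open>Apolarity and inverse systems\<close>

text \<open>
  Divisibility of monomials is stated componentwise because the order \<open>\<le>\<close> on \<^type>\<open>poly_mapping\<close>
  is lexicographic. Subtraction of exponent vectors is componentwise.
\<close>

definition apolar_monomial ::
    "('n::finite \<Rightarrow>\<^sub>0 nat) \<Rightarrow> ('n \<Rightarrow>\<^sub>0 nat) \<Rightarrow> ('n, 'k::field_char_0) mpoly" where
  "apolar_monomial \<alpha> \<beta> =
     (if \<forall>j. Poly_Mapping.lookup \<alpha> j \<le> Poly_Mapping.lookup \<beta> j
      then Poly_Mapping.single (\<beta> - \<alpha>)
        ((\<Prod>j\<in>UNIV. fact (Poly_Mapping.lookup \<beta> j)) /
         (\<Prod>j\<in>UNIV. fact (Poly_Mapping.lookup (\<beta> - \<alpha>) j)))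
      else 0)"

definition apolar ::
    "('n::finite, 'k::field_char_0) mpoly \<Rightarrow> ('n, 'k) mpoly \<Rightarrow> ('n, 'k) mpoly" (infixr \<open>\<circ>\<^sub>a\<close> 70) where
  "p \<circ>\<^sub>a \<gamma> = (\<Sum>\<alpha>\<in>Poly_Mapping.keys p. \<Sum>\<beta>\<in>Poly_Mapping.keys \<gamma>.
     const_poly (Poly_Mapping.lookup p \<alpha> * Poly_Mapping.lookup \<gamma> \<beta>) * apolar_monomial \<alpha> \<beta>)"

text \<open>The module \<open>\<Gamma>\<close> has the same underlying additive group as the polynomial ring.\<close>

definition apolar_module :: "(('n::finite, 'k::field_char_0) mpoly, ('n, 'k) mpoly) module" where
  "apolar_module = \<lparr>carrier = UNIV, monoid.mult = (*), one = 1, zero = 0, add = (+), module.smult = (\<circ>\<^sub>a)\<rparr>"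

definition inverse_system ::
    "('n::finite, 'k::field_char_0) mpoly set \<Rightarrow> ('n, 'k) mpoly set" where
  "inverse_system I = {\<gamma>. \<forall>a\<in>I. a \<circ>\<^sub>a \<gamma> = 0}"

definition inverse_system_module ::
    "('n::finite, 'k::field_char_0) mpoly set \<Rightarrow> (('n, 'k) mpoly, ('n, 'k) mpoly) module" where
  "inverse_system_module I = apolar_module\<lparr>carrier := inverse_system I\<rparr>"

definition max_ideal_inverse_system ::
    "('n::finite, 'k::field_char_0) mpoly set \<Rightarrow> ('n, 'k) mpoly set" where
  "max_ideal_inverse_system I = generated_submodule mpoly_ring (inverse_system_module I)
     {a \<circ>\<^sub>a \<gamma> |a \<gamma>. a \<in> max_ideal \<and> \<gamma> \<in> inverse_system I}"

definition matlis_dual ::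
    "(('n::finite, 'k::field_char_0) mpoly, 'b, 'm) module_scheme
      \<Rightarrow> (('n, 'k) mpoly, 'b \<Rightarrow> ('n, 'k) mpoly) module" where
  "matlis_dual N = hom_module mpoly_ring N apolar_module"

end

theory Submission
  imports Defs
begin

text \<open>
  Write \<open>S\<close> for the finite set of exponents of monomials outside \<open>I\<close>. As \<open>I\<close> is monomial, the classes
  of \<open>x\<^sup>\<alpha>\<close> with \<open>\<alpha> \<in> S\<close> form a basis of \<open>M\<close>, and \<open>I\<^sup>\<bottom>\<close> is the span of the \<open>X\<^sup>\<alpha>\<close> with \<open>\<alpha> \<in> S\<close>.
  Since every variable is nilpotent on \<open>M\<close> and a polynomial acts on the socle through its constant
  term, \<open>frakR\<close> of \<open>M\<close> is the socle, spanned by the \<open>x\<^sup>\<sigma>\<close> with \<open>\<sigma> \<in> S\<close> maximal in the sense that no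
  \<open>x\<^sub>i x\<^sup>\<sigma>\<close> lies outside \<open>I\<close>. In characteristic zero \<open>\<^bold>m \<circ> I\<^sup>\<bottom>\<close> is spanned by the \<open>X\<^sup>\<alpha>\<close> with \<open>\<alpha> \<in> S\<close> not
  maximal. A homomorphism \<open>g\<close> from the socle to \<open>\<Gamma>\<close> takes constant values, so it amounts to the class
  of \<open>\<Sum>\<^sub>\<sigma> g(x\<^sup>\<sigma>) / \<sigma>! X\<^sup>\<sigma>\<close> in \<open>I\<^sup>\<bottom> / (\<^bold>m \<circ> I\<^sup>\<bottom>)\<close>; if \<open>g\<close> is the restriction of \<open>f\<close>, then
  \<open>g(x\<^sup>\<sigma>) = x\<^sup>\<sigma> \<circ> f(1)\<close> is \<open>\<sigma>!\<close> times the coefficient of \<open>X\<^sup>\<sigma>\<close> in \<open>f(1)\<close>.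
\<close>

section \<open>Quotients of modules\<close>

lemma (in module) minus_eq_smult: "x \<in> carrier M \<Longrightarrow> \<ominus>\<^bsub>M\<^esub> x = (\<ominus> \<one>) \<odot>\<^bsub>M\<^esub> x"
  by (simp add: smult_l_minus)

text \<open>Negation is the action of \<open>\<ominus> \<one>\<close>, so its closure follows from
  closure under scalars.\<close>

lemma (in module) submoduleI':
  assumes "H \<subseteq> carrier M" "\<zero>\<^bsub>M\<^esub> \<in> H"
    and "\<And>x y. x \<in> H \<Longrightarrow> y \<in> H \<Longrightarrow> x \<oplus>\<^bsub>M\<^esub> y \<in> H"
    and "\<And>r x. r \<in> carrier R \<Longrightarrow> x \<in> H \<Longrightarrow> r \<odot>\<^bsub>M\<^esub> x \<in> H"
  shows "submodule H R M"
proof (rule submoduleI)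
  fix x assume "x \<in> H"
  then show "\<ominus>\<^bsub>M\<^esub> x \<in> H" using assms(1,4) by (subst minus_eq_smult) auto
qed (use assms in auto)

locale module_quotient = module R M + submodule L R M for L and R (structure) and M (structure)
begin

lemma abelian_subgroup: "abelian_subgroup L M"
  by (intro abelian_subgroupI3 additive_subgroupI subgroup_axioms abelian_group_axioms)

sublocale abelian_subgroup L M
  by (rule abelian_subgroup)

lemma coset_eq_iff:
  assumes "x \<in> carrier M" "y \<in> carrier M"
  shows "L +>\<^bsub>M\<^esub> x = L +>\<^bsub>M\<^esub> y \<longleftrightarrow> x \<ominus>\<^bsub>M\<^esub> y \<in> L"
  by (metis assms M.minus_eq M.a_coset_add_inv1 M.a_coset_add_inv2 M.a_coset_join1 M.a_coset_join2 M.a_inv_closed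
      M.add.m_closed a_subset a_subgroup)

lemma coset_add:
  assumes "x \<in> carrier M" "y \<in> carrier M"
  shows "(L +>\<^bsub>M\<^esub> x) \<oplus>\<^bsub>quotient_module M L\<^esub> (L +>\<^bsub>M\<^esub> y) = L +>\<^bsub>M\<^esub> (x \<oplus>\<^bsub>M\<^esub> y)"
  using assms by (simp add: quotient_module_def a_rcos_sum)

text \<open>The action on a coset is a union over all its representatives. Two of them differ by an
  element of \<open>L\<close>, which \<open>r\<close> keeps in \<open>L\<close>, so all members of
  the union are one and the same coset.\<close>

lemma coset_smult:
  assumes "r \<in> carrier R" "x \<in> carrier M"
  shows "r \<odot>\<^bsub>quotient_module M L\<^esub> (L +>\<^bsub>M\<^esub> x) = L +>\<^bsub>M\<^esub> (r \<odot>\<^bsub>M\<^esub> x)"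
proof -
  have "L +>\<^bsub>M\<^esub> (r \<odot>\<^bsub>M\<^esub> z) = L +>\<^bsub>M\<^esub> (r \<odot>\<^bsub>M\<^esub> x)" if z: "z \<in> L +>\<^bsub>M\<^esub> x" for z
  proof -
    have zM: "z \<in> carrier M"
      using z assms a_subset M.a_r_coset_subset_G by blast
    then have "z \<ominus>\<^bsub>M\<^esub> x \<in> L"
      using z assms coset_eq_iff M.a_repr_independence a_subgroup by metis
    then have "r \<odot>\<^bsub>M\<^esub> (z \<ominus>\<^bsub>M\<^esub> x) \<in> L"
      using assms by simp
    then show ?thesis
      using assms zM by (subst coset_eq_iff) (auto simp: M.minus_eq smult_r_distr smult_r_minus)
  qed
  moreover have "x \<in> L +>\<^bsub>M\<^esub> x"
    using assms a_rcos_self by blast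
  ultimately have "(\<Union>z\<in>L +>\<^bsub>M\<^esub> x. L +>\<^bsub>M\<^esub> (r \<odot>\<^bsub>M\<^esub> z)) = L +>\<^bsub>M\<^esub> (r \<odot>\<^bsub>M\<^esub> x)"
    by blast
  then show ?thesis
    by (simp add: quotient_module_def)
qed

lemma carrier_quotient_module: "carrier (quotient_module M L) = (\<lambda>x. L +>\<^bsub>M\<^esub> x) ` carrier M"
  by (auto simp: quotient_module_def A_RCOSETS_def' a_r_coset_def' r_coset_def)

lemma zero_quotient_module: "\<zero>\<^bsub>quotient_module M L\<^esub> = L +>\<^bsub>M\<^esub> \<zero>\<^bsub>M\<^esub>"
  by (simp add: quotient_module_def a_coset_add_zero a_subset)

lemma module_quotient_module: "module R (quotient_module M L)"
proof (rule moduleI)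
  show "abelian_group (quotient_module M L)"
  proof (rule abelian_groupI)
    fix C assume "C \<in> carrier (quotient_module M L)"
    then obtain x where x: "x \<in> carrier M" "C = L +>\<^bsub>M\<^esub> x"
      by (auto simp: carrier_quotient_module)
    show "\<exists>D\<in>carrier (quotient_module M L). D \<oplus>\<^bsub>quotient_module M L\<^esub> C = \<zero>\<^bsub>quotient_module M L\<^esub>"
      using x by (intro bexI[of _ "L +>\<^bsub>M\<^esub> (\<ominus>\<^bsub>M\<^esub> x)"])
        (auto simp: carrier_quotient_module coset_add zero_quotient_module M.l_neg)
  qed (auto simp: carrier_quotient_module coset_add zero_quotient_module M.a_ac)
qed (auto simp: carrier_quotient_module coset_smult coset_add smult_l_distr smult_r_distr smult_assoc1
       R.is_cring)

end

section \<open>Polynomials and apolarity\<close>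

lemma mpoly_ring_simps [simp]:
  "carrier mpoly_ring = UNIV" "monoid.mult mpoly_ring = (*)" "one mpoly_ring = 1"
  "zero mpoly_ring = 0" "add mpoly_ring = (+)"
  by (auto simp: mpoly_ring_def ring_of_type_algebra_def)

lemma cring_mpoly_ring: "cring (mpoly_ring :: ('n, 'k::field) mpoly ring)"
  unfolding mpoly_ring_def by (rule cring_from_type_algebra)

lemma ring_mpoly_ring: "ring (mpoly_ring :: ('n, 'k::field) mpoly ring)"
  by (rule cring.axioms(1)[OF cring_mpoly_ring])

lemma mpoly_ring_nat_pow [simp]: "p [^]\<^bsub>mpoly_ring\<^esub> (n::nat) = (p :: ('n, 'k::field) mpoly) ^ n"
proof -
  interpret cring "mpoly_ring :: ('n, 'k) mpoly ring" by (rule cring_mpoly_ring)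
  show ?thesis by (induction n) (auto simp: nat_pow_Suc mult.commute)
qed

lemma ideal_mpoly_ringI:
  fixes I :: "('n, 'k::field) mpoly set"
  assumes "0 \<in> I" "\<And>p q. p \<in> I \<Longrightarrow> q \<in> I \<Longrightarrow> p + q \<in> I" "\<And>p q. q \<in> I \<Longrightarrow> p * q \<in> I"
  shows "ideal I mpoly_ring"
proof (rule idealI[OF ring_mpoly_ring])
  interpret cring "mpoly_ring :: ('n, 'k) mpoly ring" by (rule cring_mpoly_ring)
  show "subgroup I (add_monoid mpoly_ring)"
  proof (rule add.subgroupI)
    fix p assume "p \<in> I"
    then have "- p \<in> I" using assms(3)[of p "- 1"] by simp
    moreover have "\<ominus>\<^bsub>mpoly_ring\<^esub> p = - p" by (rule minus_equality) auto
    ultimately show "\<ominus>\<^bsub>mpoly_ring\<^esub> p \<in> I" by simp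
  qed (use assms in auto)
qed (use assms in \<open>auto simp: mult.commute\<close>)

lemma poly_mapping_decompose:
  "p = (\<Sum>\<alpha>\<in>Poly_Mapping.keys p. Poly_Mapping.single \<alpha> (Poly_Mapping.lookup p \<alpha>))"
  by (rule poly_mapping_eqI)
    (auto simp: lookup_sum lookup_single when_def in_keys_iff sum.delta' cong: if_cong)

text \<open>Only terms of the one given \<open>p\<close> enter the \<open>single\<close> case, so
  facts about \<open>keys p\<close> remain available there.\<close>

lemma poly_mapping_additive_induct [case_names zero single add]:
  fixes p :: "'a \<Rightarrow>\<^sub>0 'b::comm_monoid_add"
  assumes "P 0"
    and "\<And>\<alpha>. \<alpha> \<in> Poly_Mapping.keys p \<Longrightarrow> P (Poly_Mapping.single \<alpha> (Poly_Mapping.lookup p \<alpha>))"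
    and "\<And>p q. P p \<Longrightarrow> P q \<Longrightarrow> P (p + q)"
  shows "P p"
proof -
  have "P (\<Sum>\<alpha>\<in>A. Poly_Mapping.single \<alpha> (Poly_Mapping.lookup p \<alpha>))"
    if "finite A" "A \<subseteq> Poly_Mapping.keys p" for A
    using that by (induction A rule: finite_induct) (auto intro: assms)
  from this[of "Poly_Mapping.keys p"] show ?thesis
    by (simp flip: poly_mapping_decompose)
qed

lemma single_eq_const_mult_monom:
  "Poly_Mapping.single \<alpha> c = const_poly c * (monom_poly \<alpha> :: ('n, 'k::field) mpoly)"
  by (simp add: const_poly_def monom_poly_def mult_single)

lemma monom_poly_mult: "monom_poly \<alpha> * monom_poly \<beta> = (monom_poly (\<alpha> + \<beta>) :: ('n, 'k::field) mpoly)"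
  by (simp add: monom_poly_def mult_single)

lemma lookup_monom_poly: "Poly_Mapping.lookup (monom_poly \<alpha> :: ('n, 'k::field) mpoly) \<beta> = (1 when \<alpha> = \<beta>)"
  by (simp add: monom_poly_def lookup_single)

lemma keys_monom_poly [simp]: "Poly_Mapping.keys (monom_poly \<alpha> :: ('n, 'k::field) mpoly) = {\<alpha>}"
  by (simp add: monom_poly_def)

lemma var_poly_power: "var_poly i ^ n = (monom_poly (Poly_Mapping.single i n) :: ('n, 'k::field) mpoly)"
proof (induction n)
  case (Suc n)
  then show ?case
    by (simp add: var_poly_def monom_poly_mult flip: single_add)
qed (simp add: monom_poly_def)

lemma lookup_var_poly_0 [simp]: "Poly_Mapping.lookup (var_poly i :: ('n, 'k::field) mpoly) 0 = 0"
proof -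
  have "Poly_Mapping.single i (1::nat) \<noteq> 0"
    by (metis lookup_single_eq lookup_zero one_neq_zero)
  then show ?thesis by (simp add: var_poly_def lookup_monom_poly)
qed

lemma lookup_const_poly_mult [simp]:
  "Poly_Mapping.lookup (const_poly c * p) \<alpha> = c * Poly_Mapping.lookup (p :: ('n, 'k::field) mpoly) \<alpha>"
  by (simp add: const_poly_def flip: mult_map_scale_conv_mult) (simp add: Poly_Mapping.map.rep_eq when_def)

lemma lookup_const_poly_0 [simp]: "Poly_Mapping.lookup (const_poly c) 0 = c"
  by (simp add: const_poly_def)

lemma const_poly_mult: "const_poly (c * d) = (const_poly c * const_poly d :: ('n, 'k::field) mpoly)"
  by (simp add: const_poly_def mult_single)

text \<open>The multi-index factorial \<alpha>! as a field element, invertible in characteristic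
  zero.\<close>

definition exp_fact :: "('n::finite \<Rightarrow>\<^sub>0 nat) \<Rightarrow> 'k::field_char_0" where
  "exp_fact \<alpha> = (\<Prod>j\<in>UNIV. fact (Poly_Mapping.lookup \<alpha> j))"

lemma exp_fact_nonzero [simp]: "exp_fact \<alpha> \<noteq> 0"
  by (simp add: exp_fact_def)

lemma exp_fact_0 [simp]: "exp_fact 0 = 1"
  by (simp add: exp_fact_def)

text \<open>Exponent subtraction is truncated; subtracting \<alpha> from \<beta> is undone by adding
  \<alpha> exactly when x^\<alpha> divides x^\<beta>. The divisibility test thus becomes the
  equation \<open>\<beta> = \<alpha> + \<delta>\<close>.\<close>

lemma lookup_apolar_monomial:
  "Poly_Mapping.lookup (apolar_monomial \<alpha> \<beta> :: ('n::finite, 'k::field_char_0) mpoly) \<delta> =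
     (if \<beta> = \<alpha> + \<delta> then exp_fact \<beta> / exp_fact \<delta> else 0)"
proof (cases "\<forall>j. Poly_Mapping.lookup \<alpha> j \<le> Poly_Mapping.lookup \<beta> j")
  case True
  then have "\<beta> = \<alpha> + (\<beta> - \<alpha>)"
    by (intro poly_mapping_eqI) (simp add: lookup_add lookup_minus)
  then have "\<beta> - \<alpha> = \<delta> \<longleftrightarrow> \<beta> = \<alpha> + \<delta>"
    by (metis add_diff_cancel_left')
  with True show ?thesis
    by (auto simp: apolar_monomial_def lookup_single when_def exp_fact_def)
next
  case False
  then have "\<beta> \<noteq> \<alpha> + \<delta>" by (auto simp: lookup_add)
  with False show ?thesis by (simp only: apolar_monomial_def if_False lookup_zero)
qed

text \<open>\<open>A\<close> may exceed \<open>keys p\<close> so that \<open>p\<close>,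
  \<open>q\<close> and \<open>p + q\<close> can be expanded over one common index set.\<close>

lemma lookup_apolar:
  fixes p \<gamma> :: "('n::finite, 'k::field_char_0) mpoly"
  assumes "finite A" "Poly_Mapping.keys p \<subseteq> A"
  shows "Poly_Mapping.lookup (p \<circ>\<^sub>a \<gamma>) \<delta> = (\<Sum>\<alpha>\<in>A. Poly_Mapping.lookup p \<alpha> *
     Poly_Mapping.lookup \<gamma> (\<alpha> + \<delta>) * (exp_fact (\<alpha> + \<delta>) / exp_fact \<delta>))"
proof -
  have "Poly_Mapping.lookup (p \<circ>\<^sub>a \<gamma>) \<delta> = (\<Sum>\<alpha>\<in>Poly_Mapping.keys p. \<Sum>\<beta>\<in>Poly_Mapping.keys \<gamma>.
     if \<beta> = \<alpha> + \<delta> then Poly_Mapping.lookup p \<alpha> * Poly_Mapping.lookup \<gamma> \<beta> * (exp_fact \<beta> / exp_fact \<delta>) else 0)"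
    unfolding apolar_def lookup_sum
    by (intro sum.cong refl) (simp add: lookup_apolar_monomial)
  also have "\<dots> = (\<Sum>\<alpha>\<in>Poly_Mapping.keys p. Poly_Mapping.lookup p \<alpha> *
     Poly_Mapping.lookup \<gamma> (\<alpha> + \<delta>) * (exp_fact (\<alpha> + \<delta>) / exp_fact \<delta>))"
    by (intro sum.cong refl) (auto simp: sum.delta in_keys_iff)
  also have "\<dots> = (\<Sum>\<alpha>\<in>A. Poly_Mapping.lookup p \<alpha> *
     Poly_Mapping.lookup \<gamma> (\<alpha> + \<delta>) * (exp_fact (\<alpha> + \<delta>) / exp_fact \<delta>))"
    using assms by (intro sum.mono_neutral_left) (auto simp: in_keys_iff)
  finally show ?thesis .
qed

lemma lookup_single_apolar:
  "Poly_Mapping.lookup (Poly_Mapping.single \<alpha> c \<circ>\<^sub>a (\<gamma> :: ('n::finite, 'k::field_char_0) mpoly)) \<delta> =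
     c * Poly_Mapping.lookup \<gamma> (\<alpha> + \<delta>) * (exp_fact (\<alpha> + \<delta>) / exp_fact \<delta>)"
  by (subst lookup_apolar[of "{\<alpha>}"]) auto

lemma apolar_add_left: "(p + q) \<circ>\<^sub>a \<gamma> = p \<circ>\<^sub>a \<gamma> + q \<circ>\<^sub>a (\<gamma> :: ('n::finite, 'k::field_char_0) mpoly)"
proof (rule poly_mapping_eqI)
  fix \<delta>
  let ?A = "Poly_Mapping.keys p \<union> Poly_Mapping.keys q"
  show "Poly_Mapping.lookup ((p + q) \<circ>\<^sub>a \<gamma>) \<delta> = Poly_Mapping.lookup (p \<circ>\<^sub>a \<gamma> + q \<circ>\<^sub>a \<gamma>) \<delta>"
    using keys_add[of p q]
    by (simp add: lookup_apolar[of ?A] lookup_add sum.distrib distrib_right add_divide_distrib)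
qed

lemma apolar_add_right: "p \<circ>\<^sub>a (\<gamma> + \<delta>) = p \<circ>\<^sub>a \<gamma> + p \<circ>\<^sub>a (\<delta> :: ('n::finite, 'k::field_char_0) mpoly)"
  by (rule poly_mapping_eqI)
    (simp add: lookup_apolar[OF finite_keys order.refl] lookup_add sum.distrib distrib_right distrib_left add_divide_distrib)

lemma apolar_zero_left [simp]: "0 \<circ>\<^sub>a \<gamma> = (0 :: ('n::finite, 'k::field_char_0) mpoly)"
  by (simp add: apolar_def)

lemma apolar_zero_right [simp]: "p \<circ>\<^sub>a 0 = (0 :: ('n::finite, 'k::field_char_0) mpoly)"
  by (simp add: apolar_def)

lemma const_poly_apolar [simp]:
  "const_poly c \<circ>\<^sub>a \<gamma> = const_poly c * (\<gamma> :: ('n::finite, 'k::field_char_0) mpoly)"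
  by (rule poly_mapping_eqI, unfold const_poly_def lookup_single_apolar, fold const_poly_def) simp

lemma apolar_one_left [simp]: "1 \<circ>\<^sub>a \<gamma> = (\<gamma> :: ('n::finite, 'k::field_char_0) mpoly)"
  using const_poly_apolar[of 1 \<gamma>] by (simp add: const_poly_def)

text \<open>By biadditivity \<open>p\<close> and \<open>q\<close> may be taken to be single terms.
  The factorial quotients then telescope: (\<alpha>+\<beta>+\<delta>)!/(\<alpha>+\<delta>)! times
  (\<alpha>+\<delta>)!/\<delta>!.\<close>

lemma apolar_mult_left:
  "(p * q) \<circ>\<^sub>a \<gamma> = p \<circ>\<^sub>a (q \<circ>\<^sub>a (\<gamma> :: ('n::finite, 'k::field_char_0) mpoly))"
proof (induction p rule: poly_mapping_additive_induct)
  case (single \<alpha>)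
  show ?case
  proof (induction q rule: poly_mapping_additive_induct)
    case (single \<beta>)
    show ?case
      by (rule poly_mapping_eqI) (simp add: mult_single lookup_single_apolar add_ac)
  qed (simp_all add: distrib_left apolar_add_left apolar_add_right)
qed (simp_all add: distrib_right apolar_add_left)

lemma apolar_diff_left: "(p - q) \<circ>\<^sub>a \<gamma> = p \<circ>\<^sub>a \<gamma> - q \<circ>\<^sub>a (\<gamma> :: ('n::finite, 'k::field_char_0) mpoly)"
  using apolar_add_left[of "p - q" q \<gamma>] by (simp add: algebra_simps)

section \<open>The modules \<Gamma>, I^\<bottom> and R\<close>

lemma apolar_module_simps [simp]:
  "carrier apolar_module = UNIV" "zero apolar_module = 0" "add apolar_module = (+)"
  "module.smult apolar_module = (\<circ>\<^sub>a)"
  by (auto simp: apolar_module_def)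

lemma module_apolar_module: "module mpoly_ring (apolar_module :: (('n::finite, 'k::field_char_0) mpoly, _) module)"
proof (rule moduleI)
  show "abelian_group (apolar_module :: (('n::finite, 'k::field_char_0) mpoly, _) module)"
    by (rule abelian_groupI) (auto simp: add_ac intro: exI[of _ "- _"])
qed (auto simp: cring_mpoly_ring apolar_add_left apolar_add_right apolar_mult_left)

lemma inverse_system_module_simps [simp]:
  "carrier (inverse_system_module I) = inverse_system I" "zero (inverse_system_module I) = 0"
  "add (inverse_system_module I) = (+)" "module.smult (inverse_system_module I) = (\<circ>\<^sub>a)"
  by (auto simp: inverse_system_module_def)

lemma module_inverse_system_module:
  "module mpoly_ring (inverse_system_module (I :: ('n::finite, 'k::field_char_0) mpoly set))"
proof -
  interpret module mpoly_ring "apolar_module :: (('n, 'k) mpoly, ('n, 'k) mpoly) module"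
    by (rule module_apolar_module)
  have "submodule (inverse_system I) mpoly_ring apolar_module"
  proof (rule submoduleI')
    fix p \<gamma> assume "\<gamma> \<in> inverse_system I"
    then have "q \<circ>\<^sub>a p \<circ>\<^sub>a \<gamma> = 0" if "q \<in> I" for q
      using that apolar_mult_left[of p q \<gamma>] apolar_mult_left[of q p \<gamma>]
      by (simp add: mult.commute inverse_system_def)
    then show "p \<odot>\<^bsub>apolar_module\<^esub> \<gamma> \<in> inverse_system I"
      by (simp add: inverse_system_def)
  qed (auto simp: inverse_system_def apolar_add_right)
  then show ?thesis
    unfolding inverse_system_module_def using module_axioms by (rule submodule.submodule_is_module)
qed

lemma regular_module_simps [simp]:
  "carrier (regular_module R) = carrier R" "zero (regular_module R) = zero R"
  "add (regular_module R) = add R" "module.smult (regular_module R) = monoid.mult R"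
  by (auto simp: regular_module_def)

lemma module_regular_module:
  assumes "cring R"
  shows "module R (regular_module R)"
proof -
  interpret cring R by fact
  show ?thesis
  proof (rule moduleI)
    show "abelian_group (regular_module R)"
      by (rule abelian_groupI) (auto simp: a_ac intro: bexI[of _ "\<ominus>\<^bsub>R\<^esub> _"] l_neg)
  qed (auto simp: l_distr r_distr m_assoc is_cring)
qed

section \<open>Standard monomials\<close>

lemma coset_regular_module [simp]: "I +>\<^bsub>regular_module R\<^esub> p = I +>\<^bsub>R\<^esub> p"
  by (simp add: a_r_coset_def r_coset_def)

definition std_exps :: "('n, 'k::field) mpoly set \<Rightarrow> ('n \<Rightarrow>\<^sub>0 nat) set" where
  "std_exps I = {\<alpha>. monom_poly \<alpha> \<notin> I}"

definition socle_exps :: "('n, 'k::field) mpoly set \<Rightarrow> ('n \<Rightarrow>\<^sub>0 nat) set" where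
  "socle_exps I = {\<alpha> \<in> std_exps I. \<forall>i. Poly_Mapping.single i 1 + \<alpha> \<notin> std_exps I}"

text \<open>Used to peel one variable off a nonconstant monomial, since \<open>socle_exps\<close>
  only tests multiplication by single variables.\<close>

lemma exp_nonzero_split:
  assumes "(\<alpha> :: 'n \<Rightarrow>\<^sub>0 nat) \<noteq> 0"
  obtains i \<alpha>' where "\<alpha> = Poly_Mapping.single i 1 + \<alpha>'"
proof -
  from assms obtain i where i: "Poly_Mapping.lookup \<alpha> i \<noteq> 0"
    by (metis poly_mapping_eqI lookup_zero)
  have "\<alpha> = Poly_Mapping.single i 1 + (\<alpha> - Poly_Mapping.single i 1)"
    using i by (intro poly_mapping_eqI) (auto simp: lookup_add lookup_minus lookup_single when_def)
  then show thesis by (rule that)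
qed

locale monomial_quotient =
  fixes I :: "('n::finite, 'k::field_char_0) mpoly set"
  assumes monomial: "monomial_ideal I"
    and colength: "finite_colength I"
begin

lemma ideal: "ideal I mpoly_ring"
  using monomial ring.genideal_ideal[OF ring_mpoly_ring] by (auto simp: monomial_ideal_def)

lemma add_mem: "p \<in> I \<Longrightarrow> q \<in> I \<Longrightarrow> p + q \<in> I"
  using additive_subgroup.a_closed[OF ideal.axioms(1)[OF ideal], of p q] by simp

lemma zero_mem: "0 \<in> I"
  using additive_subgroup.zero_closed[OF ideal.axioms(1)[OF ideal]] by simp

lemma mult_mem: "q \<in> I \<Longrightarrow> p * q \<in> I"
  using ideal.I_l_closed[OF ideal, of q p] by simp

lemma diff_mem: "p \<in> I \<Longrightarrow> q \<in> I \<Longrightarrow> p - q \<in> I"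
  using add_mem[of p "- q"] mult_mem[of q "- 1"] by simp

lemma mem_coset_iff: "p \<in> I +>\<^bsub>mpoly_ring\<^esub> q \<longleftrightarrow> p - q \<in> I"
proof -
  have "p \<in> I +>\<^bsub>mpoly_ring\<^esub> q \<longleftrightarrow> (\<exists>i\<in>I. p = i + q)"
    by (auto simp: a_r_coset_def r_coset_def)
  then show ?thesis by (metis diff_eq_eq)
qed

lemma coset_eq_iff: "I +>\<^bsub>mpoly_ring\<^esub> p = I +>\<^bsub>mpoly_ring\<^esub> q \<longleftrightarrow> p - q \<in> I"
proof
  assume "I +>\<^bsub>mpoly_ring\<^esub> p = I +>\<^bsub>mpoly_ring\<^esub> q"
  moreover have "p \<in> I +>\<^bsub>mpoly_ring\<^esub> p"
    using zero_mem by (simp add: mem_coset_iff)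
  ultimately show "p - q \<in> I"
    by (simp add: mem_coset_iff)
next
  assume *: "p - q \<in> I"
  have "r - p \<in> I \<longleftrightarrow> r - q \<in> I" for r
    using add_mem[OF _ *, of "r - p"] diff_mem[OF _ *, of "r - q"] by auto
  then show "I +>\<^bsub>mpoly_ring\<^esub> p = I +>\<^bsub>mpoly_ring\<^esub> q"
    by (auto simp: mem_coset_iff)
qed

lemma std_exps_add: "\<alpha> \<notin> std_exps I \<Longrightarrow> \<beta> + \<alpha> \<notin> std_exps I"
  using mult_mem[of "monom_poly \<alpha>" "monom_poly \<beta>"] by (simp add: std_exps_def monom_poly_mult)

text \<open>Here the monomial generators matter. Polynomials without standard exponents form an
  ideal, because nonstandard exponents stay nonstandard under addition of exponents; it contains the
  generators, hence \<open>I\<close>. Conversely, such a polynomial is a sum of scalar multiples of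
  monomials in \<open>I\<close>.\<close>

lemma mem_iff: "p \<in> I \<longleftrightarrow> Poly_Mapping.keys p \<inter> std_exps I = {}"
proof
  assume *: "Poly_Mapping.keys p \<inter> std_exps I = {}"
  show "p \<in> I"
  proof (induction p rule: poly_mapping_additive_induct)
    case (single \<alpha>)
    then show ?case
      using * by (subst single_eq_const_mult_monom) (rule mult_mem, auto simp: std_exps_def)
  qed (auto intro: zero_mem add_mem)
next
  let ?J = "{p :: ('n, 'k) mpoly. Poly_Mapping.keys p \<inter> std_exps I = {}}"
  obtain A where A: "I = Idl\<^bsub>mpoly_ring\<^esub> (monom_poly ` A)"
    using monomial by (auto simp: monomial_ideal_def)
  have "Idl\<^bsub>mpoly_ring\<^esub> (monom_poly ` A) \<subseteq> ?J"
  proof (rule ring.genideal_minimal[OF ring_mpoly_ring ideal_mpoly_ringI])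
    fix p q assume "q \<in> ?J"
    then show "p * q \<in> ?J"
      using keys_mult[of p q] std_exps_add by fastforce
  next
    fix p q assume "p \<in> ?J" "q \<in> ?J"
    then show "p + q \<in> ?J"
      using keys_add[of p q] by auto
  next
    have "monom_poly ` A \<subseteq> I"
      unfolding A by (rule ring.genideal_self[OF ring_mpoly_ring]) simp
    then show "monom_poly ` A \<subseteq> ?J"
      by (auto simp: std_exps_def)
  qed simp
  then show "p \<in> I \<Longrightarrow> Poly_Mapping.keys p \<inter> std_exps I = {}"
    using A by auto
qed

text \<open>Working modulo \<open>I\<close>, a finite-dimensional space of cosets is represented by polynomials with
  exponents in a common finite set; every standard monomial has to occur in such a representative.\<close>

lemma finite_std_exps: "finite (std_exps I)"
proof -
  interpret Q: ring "mpoly_ring Quot I"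
    by (rule ideal.quotient_is_ring[OF ideal])
  define K where "K = range (\<lambda>c. I +>\<^bsub>mpoly_ring\<^esub> (const_poly c :: ('n, 'k) mpoly))"
  \<comment> \<open>The equation \<open>K' = K\<close> lets the rule induction run with a variable
    in place of the scalar field.\<close>
  have reps: "\<exists>F. finite F \<and> (\<forall>C\<in>E. \<exists>p. C = I +>\<^bsub>mpoly_ring\<^esub> p \<and> Poly_Mapping.keys p \<subseteq> F)"
    if "Q.dimension n K' E" "K' = K" for n and K' E
    using that
  proof (induction n K' E rule: Q.dimension.induct)
    case (zero_dim K')
    have "I = I +>\<^bsub>mpoly_ring\<^esub> 0"
      by (auto simp: mem_coset_iff)
    then show ?case
      by (intro exI[of _ "{}"]) (simp add: FactRing_def exI[of _ 0])
  next
    case (Suc_dim v E n K')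
    then obtain F where F: "finite F"
      "\<And>C. C \<in> E \<Longrightarrow> \<exists>p. C = I +>\<^bsub>mpoly_ring\<^esub> p \<and> Poly_Mapping.keys p \<subseteq> F"
      by blast
    \<comment> \<open>A line extension by \<open>v\<close> enlarges the common exponent set only by
      the exponents of one representative \<open>q\<close> of \<open>v\<close>.\<close>
    obtain q where q: "v = I +>\<^bsub>mpoly_ring\<^esub> q"
      using Suc_dim.hyps(1) by (auto simp: FactRing_def A_RCOSETS_def RCOSETS_def a_r_coset_def)
    have "\<exists>p. C = I +>\<^bsub>mpoly_ring\<^esub> p \<and> Poly_Mapping.keys p \<subseteq> F \<union> Poly_Mapping.keys q"
      if C: "C \<in> Q.line_extension K' v E" for C
    proof -
      obtain c D where cD: "D \<in> E"
        "C = (I +>\<^bsub>mpoly_ring\<^esub> const_poly c) \<otimes>\<^bsub>mpoly_ring Quot I\<^esub> v \<oplus>\<^bsub>mpoly_ring Quot I\<^esub> D"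
        using C Suc_dim.prems by (auto simp: Q.line_extension_mem_iff K_def)
      obtain p where p: "D = I +>\<^bsub>mpoly_ring\<^esub> p" "Poly_Mapping.keys p \<subseteq> F"
        using F cD by blast
      have "C = I +>\<^bsub>mpoly_ring\<^esub> (const_poly c * q + p)"
        using ring_hom_mult[OF ideal.rcos_ring_hom[OF ideal]] ring_hom_add[OF ideal.rcos_ring_hom[OF ideal]]
        by (simp add: cD p q)
      moreover have "Poly_Mapping.keys (const_poly c * q + p) \<subseteq> F \<union> Poly_Mapping.keys q"
        using p(2) by (auto simp: in_keys_iff lookup_add)
      ultimately show ?thesis by blast
    qed
    then show ?case
      using F(1) by (intro exI[of _ "F \<union> Poly_Mapping.keys q"]) auto
  qed
  obtain n where "Q.dimension n K (carrier (mpoly_ring Quot I))"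
    using colength by (auto simp: finite_colength_def Q.finite_dimension_def K_def)
  from reps[OF this refl] obtain F where F: "finite F"
    "\<And>C. C \<in> carrier (mpoly_ring Quot I) \<Longrightarrow> \<exists>p. C = I +>\<^bsub>mpoly_ring\<^esub> p \<and> Poly_Mapping.keys p \<subseteq> F"
    by blast
  have "std_exps I \<subseteq> F"
  proof
    fix \<alpha> assume \<alpha>: "\<alpha> \<in> std_exps I"
    obtain p where p: "I +>\<^bsub>mpoly_ring\<^esub> monom_poly \<alpha> = I +>\<^bsub>mpoly_ring\<^esub> p" "Poly_Mapping.keys p \<subseteq> F"
      using F(2)[of "I +>\<^bsub>mpoly_ring\<^esub> monom_poly \<alpha>"]
      by (auto simp: FactRing_def A_RCOSETS_def RCOSETS_def a_r_coset_def)
    then have "monom_poly \<alpha> - p \<in> I"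
      by (simp add: coset_eq_iff)
    then have "\<alpha> \<notin> Poly_Mapping.keys (monom_poly \<alpha> - p)"
      using \<alpha> by (auto simp: mem_iff)
    then have "\<alpha> \<in> Poly_Mapping.keys p"
      by (auto simp: in_keys_iff lookup_minus lookup_monom_poly)
    then show "\<alpha> \<in> F" using p(2) by blast
  qed
  then show ?thesis using F(1) by (rule finite_subset)
qed

lemma finite_socle_exps: "finite (socle_exps I)"
  using finite_std_exps by (auto simp: socle_exps_def)

text \<open>The powers of a variable have infinitely many distinct exponents, and only finitely many
  exponents are standard.\<close>

lemma var_power_mem: obtains n where "var_poly i ^ n \<in> I"
proof -
  have "inj (Poly_Mapping.single i :: nat \<Rightarrow> _)"
    by (rule inj_single)
  then have "\<not> range (\<lambda>n::nat. Poly_Mapping.single i n) \<subseteq> std_exps I"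
    using finite_std_exps finite_subset range_inj_infinite by metis
  then show thesis
    using that by (auto simp: std_exps_def var_poly_power)
qed

section \<open>Exponents of the inverse system, and actions through the constant term\<close>

lemma std_exps_downward:
  "\<alpha> + \<delta> \<in> std_exps I \<Longrightarrow> \<delta> \<in> std_exps I"
  using std_exps_add by blast

text \<open>The constant term of \<open>monom_poly \<beta> \<circ>\<^sub>a \<gamma>\<close> is
  \<beta>! times the coefficient of \<gamma> at \<beta>, so monomials in \<open>I\<close> force
  coefficients to vanish. Conversely, for \<open>a\<close> in \<open>I\<close> the coefficient of
  \<open>a \<circ>\<^sub>a \<gamma>\<close> at \<delta> involves \<gamma> only at exponents \<alpha>
  + \<delta> with \<alpha> nonstandard, and these are nonstandard too.\<close>

lemma mem_inverse_system_iff: "\<gamma> \<in> inverse_system I \<longleftrightarrow> Poly_Mapping.keys \<gamma> \<subseteq> std_exps I"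
proof
  assume \<gamma>: "\<gamma> \<in> inverse_system I"
  show "Poly_Mapping.keys \<gamma> \<subseteq> std_exps I"
  proof
    fix \<beta> assume \<beta>: "\<beta> \<in> Poly_Mapping.keys \<gamma>"
    have "Poly_Mapping.lookup (monom_poly \<beta> \<circ>\<^sub>a \<gamma>) 0 \<noteq> 0"
      using \<beta> by (simp add: monom_poly_def lookup_single_apolar in_keys_iff)
    then show "\<beta> \<in> std_exps I"
      using \<gamma> by (auto simp: inverse_system_def std_exps_def)
  qed
next
  assume *: "Poly_Mapping.keys \<gamma> \<subseteq> std_exps I"
  have "a \<circ>\<^sub>a \<gamma> = 0" if a: "a \<in> I" for a
  proof (rule poly_mapping_eqI)
    fix \<delta>
    have "Poly_Mapping.lookup \<gamma> (\<alpha> + \<delta>) = 0" if "\<alpha> \<in> Poly_Mapping.keys a" for \<alpha>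
    proof -
      have "\<alpha> \<notin> std_exps I" using a that by (auto simp: mem_iff)
      then have "\<alpha> + \<delta> \<notin> std_exps I" by (metis add.commute std_exps_add)
      then show ?thesis using * by (auto simp: in_keys_iff)
    qed
    then show "Poly_Mapping.lookup (a \<circ>\<^sub>a \<gamma>) \<delta> = Poly_Mapping.lookup 0 \<delta>"
      by (simp add: lookup_apolar[OF finite_keys order.refl])
  qed
  then show "\<gamma> \<in> inverse_system I" by (simp add: inverse_system_def)
qed

text \<open>A term of \<open>p\<close> with exponent \<alpha> \<noteq> 0 contributes at \<delta>
  only if \<alpha> + \<delta> is standard. Then x^\<delta> and, for a variable x_i dividing
  x^\<alpha>, also x_i x^\<delta> are standard, so \<delta> is not a socle exponent.\<close>

lemma apolar_diff_const_keys:
  assumes "Poly_Mapping.keys \<gamma> \<subseteq> std_exps I"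
  shows "Poly_Mapping.keys (p \<circ>\<^sub>a \<gamma> - const_poly (Poly_Mapping.lookup p 0) * \<gamma>) \<subseteq> std_exps I - socle_exps I"
proof (induction p rule: poly_mapping_additive_induct)
  case (single \<alpha>)
  let ?c = "Poly_Mapping.lookup p \<alpha>"
  show ?case
  proof (cases "\<alpha> = 0")
    case True
    then show ?thesis by (simp flip: const_poly_def)
  next
    case False
    then obtain i \<alpha>' where \<alpha>: "\<alpha> = Poly_Mapping.single i 1 + \<alpha>'"
      by (rule exp_nonzero_split)
    have "\<delta> \<in> std_exps I - socle_exps I" if "Poly_Mapping.lookup (Poly_Mapping.single \<alpha> ?c \<circ>\<^sub>a \<gamma>) \<delta> \<noteq> 0" for \<delta>
    proof -
      have "\<alpha> + \<delta> \<in> std_exps I"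
        using that assms by (auto simp: lookup_single_apolar in_keys_iff)
      then have "Poly_Mapping.single i 1 + \<delta> \<in> std_exps I" "\<delta> \<in> std_exps I"
        using std_exps_downward[of \<alpha>' "Poly_Mapping.single i 1 + \<delta>"] std_exps_downward by (auto simp: \<alpha> add_ac)
      then show ?thesis by (auto simp: socle_exps_def)
    qed
    with False show ?thesis
      by (auto simp: in_keys_iff lookup_minus lookup_single)
  qed
next
  case (add p q)
  have "(p + q) \<circ>\<^sub>a \<gamma> - const_poly (Poly_Mapping.lookup (p + q) 0) * \<gamma> =
    (p \<circ>\<^sub>a \<gamma> - const_poly (Poly_Mapping.lookup p 0) * \<gamma>) + (q \<circ>\<^sub>a \<gamma> - const_poly (Poly_Mapping.lookup q 0) * \<gamma>)"
    by (rule poly_mapping_eqI) (simp add: apolar_add_left lookup_add lookup_minus distrib_right)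
  then show ?case
    using keys_add[of "p \<circ>\<^sub>a \<gamma> - const_poly (Poly_Mapping.lookup p 0) * \<gamma>"] add by force
qed (simp add: const_poly_def)

text \<open>The counterpart on R/I: a nonconstant term of \<open>p\<close> contains a variable,
  which carries the standard terms of \<open>q\<close> into \<open>I\<close>; the other terms of
  \<open>q\<close> lie in \<open>I\<close> already.\<close>

lemma mult_diff_const_mem:
  assumes "Poly_Mapping.keys q \<inter> std_exps I \<subseteq> socle_exps I"
  shows "p * q - const_poly (Poly_Mapping.lookup p 0) * q \<in> I"
proof (induction p rule: poly_mapping_additive_induct)
  case (single \<alpha>)
  let ?c = "Poly_Mapping.lookup p \<alpha>"
  show ?case
  proof (cases "\<alpha> = 0")
    case True
    then show ?thesis by (simp add: zero_mem flip: const_poly_def)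
  next
    case False
    then obtain i \<alpha>' where \<alpha>: "\<alpha> = Poly_Mapping.single i 1 + \<alpha>'"
      by (rule exp_nonzero_split)
    have "\<alpha> + \<beta> \<notin> std_exps I" if "\<beta> \<in> Poly_Mapping.keys q" for \<beta>
    proof (cases "\<beta> \<in> std_exps I")
      case True
      then have "Poly_Mapping.single i 1 + \<beta> \<notin> std_exps I"
        using assms that by (auto simp: socle_exps_def)
      then show ?thesis
        using std_exps_add[of "Poly_Mapping.single i 1 + \<beta>" \<alpha>'] by (simp add: \<alpha> add_ac)
    qed (rule std_exps_add)
    then have "Poly_Mapping.single \<alpha> ?c * q \<in> I"
      using keys_mult[of "Poly_Mapping.single \<alpha> ?c" q] by (fastforce simp: mem_iff split: if_splits)
    with False show ?thesis
      by (simp add: lookup_single const_poly_def)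
  qed
next
  case (add p r)
  have "(p + r) * q - const_poly (Poly_Mapping.lookup (p + r) 0) * q =
    (p * q - const_poly (Poly_Mapping.lookup p 0) * q) + (r * q - const_poly (Poly_Mapping.lookup r 0) * q)"
    by (simp add: const_poly_def lookup_add single_add algebra_simps)
  then show ?case using add add_mem by simp
qed (simp add: const_poly_def zero_mem)

text \<open>Multiplication by x_i shifts exponents injectively, so nothing cancels and membership
  can be tested term by term. The left side is visibly linear in \<open>p\<close>, which later gives
  closure properties of the socle.\<close>

lemma mult_vars_mem_iff:
  "(\<forall>i. var_poly i * p \<in> I) \<longleftrightarrow> Poly_Mapping.keys p \<inter> std_exps I \<subseteq> socle_exps I"
proof
  assume *: "\<forall>i. var_poly i * p \<in> I"
  have "Poly_Mapping.single i 1 + \<beta> \<notin> std_exps I" if "\<beta> \<in> Poly_Mapping.keys p" for i \<beta>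
  proof -
    have "Poly_Mapping.lookup (var_poly i * p) (Poly_Mapping.single i 1 + \<beta>) = Poly_Mapping.lookup p \<beta>"
      by (subst lookup_mult) (simp add: var_poly_def lookup_monom_poly when_mult)
    then have "Poly_Mapping.single i 1 + \<beta> \<in> Poly_Mapping.keys (var_poly i * p)"
      using that by (simp add: in_keys_iff)
    then show ?thesis using *[rule_format, of i] by (auto simp: mem_iff)
  qed
  then show "Poly_Mapping.keys p \<inter> std_exps I \<subseteq> socle_exps I"
    by (auto simp: socle_exps_def)
next
  assume *: "Poly_Mapping.keys p \<inter> std_exps I \<subseteq> socle_exps I"
  show "\<forall>i. var_poly i * p \<in> I"
    using mult_diff_const_mem[OF *, of "var_poly _"] by (simp add: const_poly_def)
qed

end

section \<open>The socle and the inverse system of a monomial quotient\<close>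

context monomial_quotient
begin

abbreviation M where "M \<equiv> quotient_module (regular_module (mpoly_ring :: ('n, 'k) mpoly ring)) I"

abbreviation cls where "cls p \<equiv> I +>\<^bsub>mpoly_ring\<^esub> (p :: ('n, 'k) mpoly)"

abbreviation "mIperp \<equiv> max_ideal_inverse_system I"

lemma module_quotient_M: "module_quotient I mpoly_ring (regular_module mpoly_ring)"
proof -
  interpret module mpoly_ring "regular_module (mpoly_ring :: ('n, 'k) mpoly ring)"
    by (rule module_regular_module[OF cring_mpoly_ring])
  have "submodule I mpoly_ring (regular_module mpoly_ring)"
    by (rule submoduleI') (auto intro: zero_mem add_mem mult_mem)
  then show ?thesis
    using module_axioms by (intro module_quotient.intro)
qed

sublocale M: module_quotient I "mpoly_ring :: ('n, 'k) mpoly ring" "regular_module mpoly_ring"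
  by (rule module_quotient_M)

lemma carrier_M: "carrier M = range cls"
  using M.carrier_quotient_module by simp

lemma zero_M: "\<zero>\<^bsub>M\<^esub> = cls 0"
  using M.zero_quotient_module by simp

lemma add_M [simp]: "cls p \<oplus>\<^bsub>M\<^esub> cls q = cls (p + q)"
  using M.coset_add[of p q] by simp

lemma smult_M [simp]: "r \<odot>\<^bsub>M\<^esub> cls p = cls (r * p)"
  using M.coset_smult[of r p] by simp

lemma cls_eq_zero_iff: "cls p = \<zero>\<^bsub>M\<^esub> \<longleftrightarrow> p \<in> I"
  by (simp add: zero_M coset_eq_iff)

lemma cls_mem_frakR_iff:
  "cls p \<in> frakR mpoly_ring M \<longleftrightarrow> Poly_Mapping.keys p \<inter> std_exps I \<subseteq> socle_exps I"
proof -
  have "cls p \<in> frakR mpoly_ring M \<longleftrightarrow> (\<forall>a. a\<^sup>2 * p \<in> I \<longrightarrow> a * p \<in> I)"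
    by (simp add: frakR_def carrier_M cls_eq_zero_iff)
  also have "\<dots> \<longleftrightarrow> Poly_Mapping.keys p \<inter> std_exps I \<subseteq> socle_exps I"
  proof
    assume *: "\<forall>a. a\<^sup>2 * p \<in> I \<longrightarrow> a * p \<in> I"
    \<comment> \<open>Descent on the exponent of a power of x_i that kills the class of
      \<open>p\<close>; nilpotency supplies a first such power.\<close>
    have "var_poly i * p \<in> I" if "var_poly i ^ n * p \<in> I" for i n
      using that
    proof (induction n rule: less_induct)
      case (less n)
      show ?case
      proof (cases "n \<le> 1")
        case True
        then consider "n = 0" | "n = 1" by linarith
        then show ?thesis
          using less.prems by cases (auto intro: mult_mem)
      next
        case False
        \<comment> \<open>Half of \<open>n\<close>, rounded up: \<open>2 * m\<close> reaches
          \<open>n\<close>, so the square of x_i^m kills the class of \<open>p\<close>, while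
          \<open>m < n\<close> because \<open>n\<close> is at least 2.\<close>
        define m where "m = (n + 1) div 2"
        have m: "m < n" "n \<le> 2 * m"
          using False by (auto simp: m_def)
        have "(var_poly i ^ m)\<^sup>2 * p = var_poly i ^ (2 * m - n) * (var_poly i ^ n * p)"
        proof -
          have "(var_poly i ^ m)\<^sup>2 = (var_poly i ^ (2 * m - n) * var_poly i ^ n :: ('n, 'k) mpoly)"
            using m(2) by (simp add: mult.commute[of m 2] flip: power_mult power_add)
          then show ?thesis by (simp only: mult.assoc)
        qed
        then have "var_poly i ^ m * p \<in> I"
          using less.prems * mult_mem by metis
        then show ?thesis using m(1) by (rule less.IH[rotated])
      qed
    qed
    then have "var_poly i * p \<in> I" for i
      using var_power_mem[of i] mult_mem by (metis mult.commute)
    then show "Poly_Mapping.keys p \<inter> std_exps I \<subseteq> socle_exps I"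
      using mult_vars_mem_iff by blast
  next
    assume *: "Poly_Mapping.keys p \<inter> std_exps I \<subseteq> socle_exps I"
    show "\<forall>a. a\<^sup>2 * p \<in> I \<longrightarrow> a * p \<in> I"
    proof (intro allI impI)
      fix a assume a: "a\<^sup>2 * p \<in> I"
      define c where "c = Poly_Mapping.lookup a 0"
      have a_c: "a * p - const_poly c * p \<in> I"
        unfolding c_def by (rule mult_diff_const_mem[OF *])
      \<comment> \<open>Modulo \<open>I\<close>, \<open>a\<close> acts on \<open>p\<close> as the
        scalar \<open>c\<close>. Factoring a^2 - c^2 as (a + c)(a - c) puts c^2 p in
        \<open>I\<close>; dividing by a nonzero \<open>c\<close> then gives c p in
        \<open>I\<close>.\<close>
      have "const_poly (c * c) * p = a\<^sup>2 * p - (a + const_poly c) * (a * p - const_poly c * p)"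
        by (simp add: const_poly_mult algebra_simps power2_eq_square)
      then have cc: "const_poly (c * c) * p \<in> I"
        using a a_c by (metis diff_mem mult_mem)
      have "const_poly c * p \<in> I"
      proof (cases "c = 0")
        case False
        then have "const_poly c * p = const_poly (1 / c) * (const_poly (c * c) * p)"
          by (intro poly_mapping_eqI) simp
        then show ?thesis using cc mult_mem by metis
      qed (simp add: const_poly_def zero_mem)
      with a_c show "a * p \<in> I"
        using add_mem by fastforce
    qed
  qed
  finally show ?thesis .
qed

lemma frakR_subset: "frakR mpoly_ring M \<subseteq> carrier M"
  by (auto simp: frakR_def)

lemma mem_frakRE:
  assumes "C \<in> frakR mpoly_ring M"
  obtains p where "C = cls p" "Poly_Mapping.keys p \<inter> std_exps I \<subseteq> socle_exps I"
  using assms frakR_subset cls_mem_frakR_iff by (force simp: carrier_M)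

text \<open>The defining condition with squares is not visibly additive; being killed by all
  variables is, so closure is checked in that form.\<close>

lemma submodule_frakR: "submodule (frakR mpoly_ring M) mpoly_ring M"
proof (rule module.submoduleI'[OF M.module_quotient_module frakR_subset])
  show "\<zero>\<^bsub>M\<^esub> \<in> frakR mpoly_ring M"
    by (simp add: zero_M cls_mem_frakR_iff)
next
  fix C D assume "C \<in> frakR mpoly_ring M" "D \<in> frakR mpoly_ring M"
  then show "C \<oplus>\<^bsub>M\<^esub> D \<in> frakR mpoly_ring M"
    by (elim mem_frakRE) (simp add: cls_mem_frakR_iff add_mem distrib_left flip: mult_vars_mem_iff)
next
  fix r C assume "C \<in> frakR mpoly_ring M"
  then show "r \<odot>\<^bsub>M\<^esub> C \<in> frakR mpoly_ring M"
    by (elim mem_frakRE) (simp add: cls_mem_frakR_iff mult.left_commute mult_mem flip: mult_vars_mem_iff)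
qed

section \<open>Exponents of the submodule of I^\<bottom> generated by the maximal ideal\<close>

lemma submodule_nonsocle:
  "submodule {\<gamma>. Poly_Mapping.keys \<gamma> \<subseteq> std_exps I - socle_exps I} mpoly_ring (inverse_system_module I)"
  (is "submodule ?T _ _")
proof (rule module.submoduleI'[OF module_inverse_system_module])
  fix p \<gamma> assume \<gamma>: "\<gamma> \<in> ?T"
  \<comment> \<open>\<open>p \<circ>\<^sub>a \<gamma>\<close> is \<open>?d\<close> plus a scalar
    multiple of \<gamma>, and both have only nonsocle standard exponents.\<close>
  let ?d = "p \<circ>\<^sub>a \<gamma> - const_poly (Poly_Mapping.lookup p 0) * \<gamma>"
  have "Poly_Mapping.keys (const_poly (Poly_Mapping.lookup p 0) * \<gamma>) \<subseteq> Poly_Mapping.keys \<gamma>"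
    by (auto simp: in_keys_iff)
  moreover have "Poly_Mapping.keys ?d \<subseteq> std_exps I - socle_exps I"
    using \<gamma> by (intro apolar_diff_const_keys) auto
  ultimately have "Poly_Mapping.keys (?d + const_poly (Poly_Mapping.lookup p 0) * \<gamma>) \<subseteq> std_exps I - socle_exps I"
    using \<gamma> keys_add[of ?d] by blast
  then show "p \<odot>\<^bsub>inverse_system_module I\<^esub> \<gamma> \<in> ?T" by simp
next
  fix \<gamma> \<delta> assume "\<gamma> \<in> ?T" "\<delta> \<in> ?T"
  then show "\<gamma> \<oplus>\<^bsub>inverse_system_module I\<^esub> \<delta> \<in> ?T"
    using keys_add[of \<gamma> \<delta>] by auto
qed (auto simp: mem_inverse_system_iff)

lemma mIperp_eq: "mIperp = {\<gamma>. Poly_Mapping.keys \<gamma> \<subseteq> std_exps I - socle_exps I}" (is "_ = ?T")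
proof
  let ?G = "{a \<circ>\<^sub>a \<gamma> |a \<gamma>. a \<in> max_ideal \<and> \<gamma> \<in> inverse_system I}"
  \<comment> \<open>Polynomials without constant term form an ideal containing the variables. The
    action of such polynomials thus leaves only nonsocle exponents.\<close>
  have max0: "Poly_Mapping.lookup a 0 = 0" if "a \<in> max_ideal" for a :: "('n, 'k) mpoly"
  proof -
    let ?J = "{a :: ('n, 'k) mpoly. Poly_Mapping.lookup a 0 = 0}"
    have zero: "0 = \<alpha> + \<beta> \<longleftrightarrow> \<alpha> = 0 \<and> \<beta> = 0" for \<alpha> \<beta> :: "'n \<Rightarrow>\<^sub>0 nat"
      by (auto simp: poly_mapping_eq_iff fun_eq_iff lookup_add)
    have "0 \<notin> Poly_Mapping.keys (p * q)" if "0 \<notin> Poly_Mapping.keys q" for p q :: "('n, 'k) mpoly"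
      using keys_mult[of p q] that zero by fastforce
    then have "ideal ?J mpoly_ring"
      by (intro ideal_mpoly_ringI) (auto simp: lookup_add in_keys_iff)
    then have "max_ideal \<subseteq> ?J"
      unfolding max_ideal_def by (intro ring.genideal_minimal[OF ring_mpoly_ring]) auto
    with that show ?thesis by auto
  qed
  have "?G \<subseteq> ?T"
  proof
    fix \<delta> assume "\<delta> \<in> ?G"
    then obtain a \<gamma> where "\<delta> = a \<circ>\<^sub>a \<gamma>" "a \<in> max_ideal" "\<gamma> \<in> inverse_system I"
      by auto
    with apolar_diff_const_keys[of \<gamma> a] show "\<delta> \<in> ?T"
      by (simp add: mem_inverse_system_iff max0 const_poly_def)
  qed
  with submodule_nonsocle show "mIperp \<subseteq> ?T"
    unfolding max_ideal_inverse_system_def generated_submodule_def by blast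
  have "\<gamma> \<in> L" if L: "submodule L mpoly_ring (inverse_system_module I)" "?G \<subseteq> L" and \<gamma>: "\<gamma> \<in> ?T" for L \<gamma>
  proof -
    have "subgroup L (add_monoid (inverse_system_module I))"
      using L(1) by (rule submodule.axioms)
    show ?thesis
    proof (induction \<gamma> rule: poly_mapping_additive_induct)
      case zero
      show ?case
        using subgroup.one_closed[OF \<open>subgroup L _\<close>] by simp
    next
      case (single \<alpha>)
      then have "\<alpha> \<in> std_exps I - socle_exps I"
        using \<gamma> by auto
      then obtain i where i: "Poly_Mapping.single i 1 + \<alpha> \<in> std_exps I"
        by (auto simp: socle_exps_def)
      define \<beta> where "\<beta> = Poly_Mapping.single i 1 + \<alpha>"
      \<comment> \<open>The multiple of X^\<beta> that x_i sends to the wanted term: x_i takes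
        X^\<beta> to \<beta>!/\<alpha>! X^\<alpha>, and characteristic zero allows the division by
        \<beta>!.\<close>
      define \<delta> where "\<delta> = Poly_Mapping.single \<beta> (Poly_Mapping.lookup \<gamma> \<alpha> * exp_fact \<alpha> / exp_fact \<beta>)"
      have "var_poly i \<in> (max_ideal :: ('n, 'k) mpoly set)"
        unfolding max_ideal_def using ring.genideal_self[OF ring_mpoly_ring, of "range var_poly"] by auto
      moreover have "\<delta> \<in> inverse_system I"
        using i by (simp add: mem_inverse_system_iff \<delta>_def \<beta>_def)
      moreover have "var_poly i \<circ>\<^sub>a \<delta> = Poly_Mapping.single \<alpha> (Poly_Mapping.lookup \<gamma> \<alpha>)"
        by (rule poly_mapping_eqI)
          (auto simp: var_poly_def monom_poly_def lookup_single_apolar \<delta>_def lookup_single when_def \<beta>_def)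
      ultimately have "Poly_Mapping.single \<alpha> (Poly_Mapping.lookup \<gamma> \<alpha>) \<in> ?G"
        by (intro CollectI exI[of _ "var_poly i"] exI[of _ \<delta>]) simp
      then show ?case using L(2) by (rule rev_subsetD)
    next
      case (add p q)
      show ?case
        using subgroup.m_closed[OF \<open>subgroup L _\<close>, of p q] add by simp
    qed
  qed
  then show "?T \<subseteq> mIperp"
    unfolding max_ideal_inverse_system_def generated_submodule_def by blast
qed

lemma submodule_mIperp: "submodule mIperp mpoly_ring (inverse_system_module I)"
  using submodule_nonsocle by (simp add: mIperp_eq)

end

section \<open>Matlis duals\<close>

lemma matlis_dual_simps:
  "carrier (matlis_dual N) = module_homs mpoly_ring N apolar_module \<inter> extensional (carrier N)"
  "add (matlis_dual N) = (\<lambda>f g. \<lambda>x\<in>carrier N. f x + g x)"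
  "module.smult (matlis_dual N) = (\<lambda>r f. \<lambda>x\<in>carrier N. r \<circ>\<^sub>a f x)"
  by (auto simp: matlis_dual_def hom_module_def fun_eq_iff)

lemma matlis_dual_restrict:
  assumes "f \<in> carrier (matlis_dual N)" "submodule H mpoly_ring N"
  shows "restrict f H \<in> carrier (matlis_dual (N\<lparr>carrier := H\<rparr>))"
proof -
  have "subgroup H (add_monoid N)"
    using assms(2) by (rule submodule.axioms)
  then have "H \<subseteq> carrier N" "\<And>x y. x \<in> H \<Longrightarrow> y \<in> H \<Longrightarrow> x \<oplus>\<^bsub>N\<^esub> y \<in> H"
    using subgroup.subset subgroup.m_closed by fastforce+
  moreover have "r \<odot>\<^bsub>N\<^esub> x \<in> H" if "x \<in> H" for r x
    using submodule.smult_closed[OF assms(2), of r x] that by simp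
  ultimately show ?thesis
    using assms(1) by (auto simp: matlis_dual_simps module_homs_def subset_iff)
qed

section \<open>The dual of R/I as the inverse system\<close>

context monomial_quotient
begin

lemma matlis_dual_M_smult:
  assumes "f \<in> carrier (matlis_dual M)"
  shows "f (cls (p * q)) = p \<circ>\<^sub>a f (cls q)"
proof -
  have "f (p \<odot>\<^bsub>M\<^esub> cls q) = p \<circ>\<^sub>a f (cls q)"
    using assms by (auto simp del: smult_M simp: matlis_dual_simps module_homs_def carrier_M)
  then show ?thesis by simp
qed

text \<open>The class of 1 generates \<open>M\<close>, so a homomorphism is determined by its value
  there.\<close>

lemma matlis_dual_M_eval:
  assumes "f \<in> carrier (matlis_dual M)"
  shows "f (cls p) = p \<circ>\<^sub>a f (cls 1)"
  using matlis_dual_M_smult[OF assms, of p 1] by simp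

lemma eval_one_iso:
  "(\<lambda>f. f (cls 1)) \<in> module_isos mpoly_ring (matlis_dual M) (inverse_system_module I)"
proof -
  have closed: "f (cls 1) \<in> inverse_system I" if f: "f \<in> carrier (matlis_dual M)" for f
  proof -
    have "a \<circ>\<^sub>a f (cls 1) = 0" if "a \<in> I" for a
    proof -
      have "cls a = cls 0" using that by (simp add: coset_eq_iff)
      then show ?thesis
        using matlis_dual_M_eval[OF f, of a] matlis_dual_M_eval[OF f, of 0] by simp
    qed
    then show ?thesis by (simp add: inverse_system_def)
  qed
  have "bij_betw (\<lambda>f. f (cls 1)) (carrier (matlis_dual M)) (inverse_system I)"
  proof (rule bij_betwI')
    fix f g assume fg: "f \<in> carrier (matlis_dual M)" "g \<in> carrier (matlis_dual M)"
    show "f (cls 1) = g (cls 1) \<longleftrightarrow> f = g"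
    proof
      assume eq: "f (cls 1) = g (cls 1)"
      show "f = g"
      proof (rule extensionalityI)
        fix C assume "C \<in> carrier M"
        then obtain p where "C = cls p" by (auto simp: carrier_M)
        then show "f C = g C"
          using matlis_dual_M_eval[OF fg(1), of p] matlis_dual_M_eval[OF fg(2), of p] eq by metis
      qed (use fg in \<open>auto simp: matlis_dual_simps\<close>)
    qed simp
  next
    fix \<gamma> assume \<gamma>: "\<gamma> \<in> inverse_system I"
    \<comment> \<open>The inverse sends \<gamma> to the map
      \<open>p \<circ>\<^sub>a \<gamma>\<close> on the class of \<open>p\<close>, computed on a
      chosen representative; any other one differs by an element of \<open>I\<close>, which kills
      \<gamma>.\<close>
    define f where "f = (\<lambda>C\<in>carrier M. (SOME p. p \<in> C) \<circ>\<^sub>a \<gamma>)"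
    have f_cls: "f (cls p) = p \<circ>\<^sub>a \<gamma>" for p
    proof -
      have "p \<in> cls p" by (simp add: mem_coset_iff zero_mem)
      then have "(SOME q. q \<in> cls p) \<in> cls p" by (rule someI)
      then have "((SOME q. q \<in> cls p) - p) \<circ>\<^sub>a \<gamma> = 0"
        using \<gamma> by (simp add: mem_coset_iff inverse_system_def)
      then show ?thesis by (simp add: f_def carrier_M apolar_diff_left)
    qed
    have "f \<in> carrier (matlis_dual M)"
      unfolding matlis_dual_simps module_homs_def
      by (auto simp: carrier_M f_cls apolar_add_left apolar_mult_left) (simp add: f_def carrier_M extensional_def)
    then show "\<exists>f\<in>carrier (matlis_dual M). \<gamma> = f (cls 1)"
      by (rule bexI[rotated]) (simp add: f_cls)
  qed (rule closed)
  then show ?thesis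
    using closed by (auto simp: module_isos_def module_homs_def matlis_dual_simps carrier_M)
qed

section \<open>Homomorphisms from the socle to \<Gamma>\<close>

abbreviation N where "N \<equiv> M\<lparr>carrier := frakR mpoly_ring M\<rparr>"

lemma cls_mem_N:
  "\<alpha> \<in> socle_exps I \<Longrightarrow> cls (monom_poly \<alpha>) \<in> frakR mpoly_ring M"
  by (auto simp: cls_mem_frakR_iff)

lemma matlis_dual_N_add:
  assumes "g \<in> carrier (matlis_dual N)" "cls p \<in> frakR mpoly_ring M" "cls q \<in> frakR mpoly_ring M"
  shows "g (cls (p + q)) = g (cls p) + g (cls q)"
proof -
  have "g (cls p \<oplus>\<^bsub>M\<^esub> cls q) = g (cls p) + g (cls q)"
    using assms by (auto simp del: add_M simp: matlis_dual_simps module_homs_def)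
  then show ?thesis by simp
qed

lemma matlis_dual_N_smult:
  assumes "g \<in> carrier (matlis_dual N)" "cls q \<in> frakR mpoly_ring M"
  shows "g (cls (p * q)) = p \<circ>\<^sub>a g (cls q)"
proof -
  have "g (p \<odot>\<^bsub>M\<^esub> cls q) = p \<circ>\<^sub>a g (cls q)"
    using assms by (auto simp del: smult_M simp: matlis_dual_simps module_homs_def)
  then show ?thesis by simp
qed

text \<open>The maximal ideal annihilates the socle, so every value of \<open>g\<close> is annihilated by it too.\<close>

lemma matlis_dual_N_apolar:
  assumes "g \<in> carrier (matlis_dual N)" "cls q \<in> frakR mpoly_ring M"
  shows "p \<circ>\<^sub>a g (cls q) = const_poly (Poly_Mapping.lookup p 0) * g (cls q)"
proof -
  have "cls (p * q) = cls (const_poly (Poly_Mapping.lookup p 0) * q)"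
    using assms(2) by (simp add: coset_eq_iff cls_mem_frakR_iff mult_diff_const_mem)
  then show ?thesis
    by (metis assms matlis_dual_N_smult const_poly_apolar)
qed

text \<open>Every x^\<alpha> with \<alpha> \<noteq> 0 kills the value of \<open>g\<close>, and its
  action produces \<alpha>! times the coefficient at \<alpha> as constant term; in characteristic
  zero that coefficient vanishes.\<close>

lemma matlis_dual_N_const:
  assumes "g \<in> carrier (matlis_dual N)" "cls q \<in> frakR mpoly_ring M"
  shows "g (cls q) = const_poly (Poly_Mapping.lookup (g (cls q)) 0)"
proof (rule poly_mapping_eqI)
  fix \<alpha>
  show "Poly_Mapping.lookup (g (cls q)) \<alpha> = Poly_Mapping.lookup (const_poly (Poly_Mapping.lookup (g (cls q)) 0)) \<alpha>"
  proof (cases "\<alpha> = 0")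
    case False
    then have "Poly_Mapping.lookup (monom_poly \<alpha> \<circ>\<^sub>a g (cls q)) 0 = 0"
      unfolding matlis_dual_N_apolar[OF assms, of "monom_poly \<alpha>"] by (simp add: lookup_monom_poly)
    then have "Poly_Mapping.lookup (g (cls q)) \<alpha> = 0"
      by (simp add: monom_poly_def lookup_single_apolar)
    with False show ?thesis by (simp add: const_poly_def lookup_single)
  qed simp
qed

text \<open>Dividing by \<sigma>! compensates for the fact that x^\<sigma> sends X^\<sigma> to
  \<sigma>!; the lookup at 0 turns the constant value of \<open>g\<close> into a scalar.\<close>

definition dual_rep :: "(('n, 'k) mpoly set \<Rightarrow> ('n, 'k) mpoly) \<Rightarrow> ('n, 'k) mpoly" where
  "dual_rep g = (\<Sum>\<sigma>\<in>socle_exps I. Poly_Mapping.single \<sigma>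
     (Poly_Mapping.lookup (g (cls (monom_poly \<sigma>))) 0 / exp_fact \<sigma>))"

lemma lookup_dual_rep:
  "Poly_Mapping.lookup (dual_rep g) \<alpha> =
     (if \<alpha> \<in> socle_exps I then Poly_Mapping.lookup (g (cls (monom_poly \<alpha>))) 0 / exp_fact \<alpha> else 0)"
  by (simp add: dual_rep_def lookup_sum lookup_single when_def finite_socle_exps)

lemma dual_rep_mem: "dual_rep g \<in> inverse_system I"
  by (auto simp: mem_inverse_system_iff in_keys_iff lookup_dual_rep socle_exps_def split: if_splits)

text \<open>The coefficients of \<open>dual_rep g\<close> recover the constant values of
  \<open>g\<close> on the socle monomials, and these span the domain.\<close>

lemma dual_rep_inj:
  assumes "g \<in> carrier (matlis_dual N)" "h \<in> carrier (matlis_dual N)"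
    and eq: "dual_rep g = dual_rep h"
  shows "g = h"
proof (rule extensionalityI)
  fix C assume "C \<in> frakR mpoly_ring M"
  then obtain p where C: "C = cls p" and p: "Poly_Mapping.keys p \<inter> std_exps I \<subseteq> socle_exps I"
    by (rule mem_frakRE)
  \<comment> \<open>Membership in the socle is carried along because \<open>g\<close> and
    \<open>h\<close> are additive only on their domain.\<close>
  have "cls p \<in> frakR mpoly_ring M \<and> g (cls p) = h (cls p)"
  proof (induction p rule: poly_mapping_additive_induct)
    case zero
    have 0: "cls 0 \<in> frakR mpoly_ring M" by (simp add: cls_mem_frakR_iff)
    then show ?case
      using matlis_dual_N_smult[OF assms(1) 0, of 0] matlis_dual_N_smult[OF assms(2) 0, of 0] by simp
  next
    case (single \<alpha>)
    let ?c = "Poly_Mapping.lookup p \<alpha>"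
    show ?case
    proof (cases "\<alpha> \<in> std_exps I")
      case True
      then have \<alpha>: "\<alpha> \<in> socle_exps I" using single p by auto
      note mem = cls_mem_N[OF \<alpha>]
      have "Poly_Mapping.lookup (dual_rep g) \<alpha> = Poly_Mapping.lookup (dual_rep h) \<alpha>"
        by (simp add: eq)
      then have "Poly_Mapping.lookup (g (cls (monom_poly \<alpha>))) 0 = Poly_Mapping.lookup (h (cls (monom_poly \<alpha>))) 0"
        using \<alpha> by (simp add: lookup_dual_rep)
      then have "g (cls (monom_poly \<alpha>)) = h (cls (monom_poly \<alpha>))"
        using matlis_dual_N_const[OF assms(1) mem] matlis_dual_N_const[OF assms(2) mem] by metis
      then have "g (cls (Poly_Mapping.single \<alpha> ?c)) = h (cls (Poly_Mapping.single \<alpha> ?c))"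
        unfolding single_eq_const_mult_monom matlis_dual_N_smult[OF assms(1) mem] matlis_dual_N_smult[OF assms(2) mem]
        by simp
      then show ?thesis
        using \<alpha> by (auto simp: cls_mem_frakR_iff)
    next
      \<comment> \<open>\<open>p\<close> is an arbitrary representative and may contain terms of
        \<open>I\<close>; their class is zero.\<close>
      case False
      then have "Poly_Mapping.single \<alpha> ?c \<in> I" by (simp add: mem_iff)
      then have "cls (Poly_Mapping.single \<alpha> ?c) = cls 0" by (simp add: coset_eq_iff)
      moreover have 0: "cls 0 \<in> frakR mpoly_ring M" by (simp add: cls_mem_frakR_iff)
      ultimately show ?thesis
        using matlis_dual_N_smult[OF assms(1) 0, of 0] matlis_dual_N_smult[OF assms(2) 0, of 0] by simp
    qed
  next
    case (add p q)
    moreover from add have "cls (p + q) \<in> frakR mpoly_ring M"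
      by (simp add: cls_mem_frakR_iff add_mem distrib_left flip: mult_vars_mem_iff)
    ultimately show ?case
      using matlis_dual_N_add[OF assms(1)] matlis_dual_N_add[OF assms(2)] by simp
  qed
  then show "g C = h C" by (simp add: C)
qed (use assms in \<open>auto simp: matlis_dual_simps\<close>)

section \<open>The quotient of I^\<bottom> and the dual of the socle\<close>

sublocale Iperp: module_quotient mIperp "mpoly_ring :: ('n, 'k) mpoly ring" "inverse_system_module I"
  using submodule_mIperp module_inverse_system_module by (intro module_quotient.intro)

abbreviation dual_cls where "dual_cls \<gamma> \<equiv> mIperp +>\<^bsub>inverse_system_module I\<^esub> (\<gamma> :: ('n, 'k) mpoly)"

text \<open>Dividing by \<open>mIperp\<close> discards precisely the nonsocle standard exponents, so
  the coefficients at socle exponents are coordinates on the quotient.\<close>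

lemma dual_cls_eq_iff:
  assumes "\<gamma> \<in> inverse_system I" "\<delta> \<in> inverse_system I"
  shows "dual_cls \<gamma> = dual_cls \<delta> \<longleftrightarrow> (\<forall>\<sigma>\<in>socle_exps I. Poly_Mapping.lookup \<gamma> \<sigma> = Poly_Mapping.lookup \<delta> \<sigma>)"
proof -
  have minus: "\<ominus>\<^bsub>inverse_system_module I\<^esub> \<delta> = - \<delta>"
    using assms Iperp.M.minus_equality[of "- \<delta>" \<delta>] by (simp add: mem_inverse_system_iff)
  have "dual_cls \<gamma> = dual_cls \<delta> \<longleftrightarrow> \<gamma> - \<delta> \<in> mIperp"
    using Iperp.coset_eq_iff[of \<gamma> \<delta>] assms by (simp add: a_minus_def minus)
  also have "\<dots> \<longleftrightarrow> Poly_Mapping.keys (\<gamma> - \<delta>) \<inter> socle_exps I = {}"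
  proof -
    have "Poly_Mapping.keys (\<gamma> - \<delta>) \<subseteq> Poly_Mapping.keys \<gamma> \<union> Poly_Mapping.keys \<delta>"
      by (auto simp: in_keys_iff lookup_minus)
    then have "Poly_Mapping.keys (\<gamma> - \<delta>) \<subseteq> std_exps I"
      using assms unfolding mem_inverse_system_iff by blast
    then show ?thesis unfolding mIperp_eq by blast
  qed
  also have "\<dots> \<longleftrightarrow> (\<forall>\<sigma>\<in>socle_exps I. Poly_Mapping.lookup \<gamma> \<sigma> = Poly_Mapping.lookup \<delta> \<sigma>)"
    unfolding disjoint_iff in_keys_iff lookup_minus by auto
  finally show ?thesis .
qed

text \<open>This is the commuting square with the canonical surjection. The factor \<sigma>!
  produced by x^\<sigma> acting on \<open>f (cls 1)\<close> cancels the one in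
  \<open>dual_rep\<close>, and coefficients elsewhere are invisible modulo
  \<open>mIperp\<close>.\<close>

lemma dual_cls_dual_rep_restrict:
  assumes f: "f \<in> carrier (matlis_dual M)"
  shows "dual_cls (dual_rep (restrict f (carrier N))) = dual_cls (f (cls 1))"
proof -
  have "f (cls 1) \<in> inverse_system I"
    using eval_one_iso f by (auto simp: module_isos_def module_homs_def)
  moreover have "Poly_Mapping.lookup (f (cls (monom_poly \<sigma>))) 0 = Poly_Mapping.lookup (f (cls 1)) \<sigma> * exp_fact \<sigma>" for \<sigma>
    unfolding matlis_dual_M_eval[OF f, of "monom_poly \<sigma>"] by (simp add: monom_poly_def lookup_single_apolar)
  ultimately show ?thesis
    by (simp add: dual_cls_eq_iff dual_rep_mem lookup_dual_rep cls_mem_N)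
qed

lemma dual_rep_iso:
  "(\<lambda>g. dual_cls (dual_rep g)) \<in> module_isos mpoly_ring (matlis_dual N)
     (quotient_module (inverse_system_module I) mIperp)"
proof -
  have carrier: "carrier (quotient_module (inverse_system_module I) mIperp) = dual_cls ` inverse_system I"
    using Iperp.carrier_quotient_module by simp
  have add: "dual_cls (dual_rep (g \<oplus>\<^bsub>matlis_dual N\<^esub> h)) =
      dual_cls (dual_rep g) \<oplus>\<^bsub>quotient_module (inverse_system_module I) mIperp\<^esub> dual_cls (dual_rep h)" for g h
  proof -
    have "dual_rep (g \<oplus>\<^bsub>matlis_dual N\<^esub> h) = dual_rep g + dual_rep h"
      by (rule poly_mapping_eqI)
        (simp add: lookup_dual_rep lookup_add matlis_dual_simps cls_mem_N add_divide_distrib)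
    then show ?thesis
      using Iperp.coset_add[of "dual_rep g" "dual_rep h"] by (simp add: dual_rep_mem)
  qed
  have smult: "dual_cls (dual_rep (r \<odot>\<^bsub>matlis_dual N\<^esub> g)) =
      r \<odot>\<^bsub>quotient_module (inverse_system_module I) mIperp\<^esub> dual_cls (dual_rep g)"
    if g: "g \<in> carrier (matlis_dual N)" for r g
  proof -
    have r: "r \<circ>\<^sub>a dual_rep g \<in> inverse_system I"
      using module.smult_closed[OF module_inverse_system_module, of r "dual_rep g"] by (simp add: dual_rep_mem)
    \<comment> \<open>The two polynomials need agree only at socle exponents. There \<open>r\<close>
      acts through its constant term on both sides: on values of \<open>g\<close> because the socle
      is killed by the variables, on \<open>dual_rep g\<close> up to nonsocle exponents.\<close>
    have "Poly_Mapping.lookup (dual_rep (r \<odot>\<^bsub>matlis_dual N\<^esub> g)) \<sigma> = Poly_Mapping.lookup (r \<circ>\<^sub>a dual_rep g) \<sigma>"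
      if \<sigma>: "\<sigma> \<in> socle_exps I" for \<sigma>
    proof -
      have "\<sigma> \<notin> Poly_Mapping.keys (r \<circ>\<^sub>a dual_rep g - const_poly (Poly_Mapping.lookup r 0) * dual_rep g)"
        using apolar_diff_const_keys[of "dual_rep g" r] dual_rep_mem \<sigma> by (auto simp: mem_inverse_system_iff)
      then have "Poly_Mapping.lookup (r \<circ>\<^sub>a dual_rep g) \<sigma> = Poly_Mapping.lookup r 0 * Poly_Mapping.lookup (dual_rep g) \<sigma>"
        by (simp add: in_keys_iff lookup_minus)
      then show ?thesis
        using \<sigma> by (simp add: lookup_dual_rep matlis_dual_simps cls_mem_N matlis_dual_N_apolar[OF g])
    qed
    then show ?thesis
      using Iperp.coset_smult[of r "dual_rep g"] r by (simp add: dual_rep_mem dual_cls_eq_iff)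
  qed
  have "bij_betw (\<lambda>g. dual_cls (dual_rep g)) (carrier (matlis_dual N)) (dual_cls ` inverse_system I)"
  proof (rule bij_betwI')
    fix g h assume gh: "g \<in> carrier (matlis_dual N)" "h \<in> carrier (matlis_dual N)"
    show "dual_cls (dual_rep g) = dual_cls (dual_rep h) \<longleftrightarrow> g = h"
    proof
      assume "dual_cls (dual_rep g) = dual_cls (dual_rep h)"
      then have "Poly_Mapping.lookup (dual_rep g) \<sigma> = Poly_Mapping.lookup (dual_rep h) \<sigma>" for \<sigma>
        by (cases "\<sigma> \<in> socle_exps I") (simp_all add: dual_rep_mem dual_cls_eq_iff lookup_dual_rep)
      then show "g = h"
        using gh by (intro dual_rep_inj poly_mapping_eqI)
    qed simp
  next
    fix C assume "C \<in> dual_cls ` inverse_system I"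
    then obtain \<gamma> where "\<gamma> \<in> inverse_system I" "C = dual_cls \<gamma>" by auto
    \<comment> \<open>Surjectivity is inherited from \<open>M\<close>: \<gamma> is the value at 1 of
      some \<open>f\<close>, and the restriction of \<open>f\<close> to the socle is sent to the
      class of \<gamma>.\<close>
    moreover from this obtain f where "f \<in> carrier (matlis_dual M)" "\<gamma> = f (cls 1)"
      using eval_one_iso by (auto simp: module_isos_def bij_betw_def)
    ultimately show "\<exists>g\<in>carrier (matlis_dual N). C = dual_cls (dual_rep g)"
      using dual_cls_dual_rep_restrict[of f] matlis_dual_restrict[OF _ submodule_frakR, of f]
      by (intro bexI[of _ "restrict f (carrier N)"]) simp_all
  qed (auto simp: dual_rep_mem)
  then show ?thesis
    using add smult by (auto simp: module_isos_def module_homs_def carrier dual_rep_mem)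
qed

end

text \<open>Equality as quotients of I^\<bottom> is expressed by a commuting square: evaluation at 1
  identifies the dual of \<open>M\<close>, and under \<phi> restriction to the socle becomes the
  canonical surjection.\<close>

theorem proposition3p1:
  fixes I :: "('n::finite, 'k::{alg_closed_field, field_char_0}) mpoly set"
  defines "R \<equiv> (mpoly_ring :: ('n, 'k) mpoly ring)"
  defines "M \<equiv> quotient_module (regular_module R) I"
  defines "N \<equiv> M\<lparr>carrier := frakR R M\<rparr>"
  defines "Iperp \<equiv> inverse_system_module I"
  defines "mIperp \<equiv> max_ideal_inverse_system I"
  assumes "monomial_ideal I"
    and "finite_colength I"
  shows "submodule (frakR R M) R M
    \<and> (\<lambda>f. f (I +>\<^bsub>R\<^esub> \<one>\<^bsub>R\<^esub>)) \<in> module_isos R (matlis_dual M) Iperp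
    \<and> (\<exists>\<phi> \<in> module_isos R (matlis_dual N) (quotient_module Iperp mIperp).
         \<forall>f \<in> carrier (matlis_dual M).
           \<phi> (restrict f (carrier N)) = mIperp +>\<^bsub>Iperp\<^esub> f (I +>\<^bsub>R\<^esub> \<one>\<^bsub>R\<^esub>))"
proof -
  interpret monomial_quotient I
    using assms by unfold_locales
  show ?thesis
    unfolding N_def M_def Iperp_def mIperp_def R_def mpoly_ring_simps
    by (intro conjI submodule_frakR eval_one_iso bexI[OF _ dual_rep_iso] ballI dual_cls_dual_rep_restrict)
qed

end
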